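(* Let $\mathcal{M}'_1=(\mathcal{N}',\mathcal{I}'_1,w)$ and $\mathcal{M}'_2=(\mathcal{N}',\mathcal{I}'_2,w)$ be weighted matroids with $w(e)\in\{1,2,\dots,W\}$ for all $e\in\mathcal{N}'$, and let $\mathrm{OPT}'$ be the maximum weight of a common independent set of $\mathcal{M}'_1,\mathcal{M}'_2$. Let $\mathcal{M}_1=(\mathcal{N},\mathcal{I}_1)$, $\mathcal{M}_2=(\mathcal{N},\mathcal{I}_2)$ be the unfolded instance and $\mathrm{OPT}$ the maximum cardinality of a common independent set of $\mathcal{M}_1,\mathcal{M}_2$. Then $\mathrm{OPT}=\mathrm{OPT}'$.
   Context: Unfolding: the ground set $\mathcal{N}$ consists of copies $e_1,\dots,e_{w(e)}$ for each $e\in\mathcal{N}'$. For $I\subseteq\mathcal{N}$ and $i\in[W]$ let $I'_{1,i}=\{e: e_i\in I\}$ and $I'_{2,i}=\{e: e_{w(e)-i+1}\in I\}$. Then $I\in\mathcal{I}_1$ iff $I'_{1,i}\in\mathcal{I}'_1$ for all $i\in[W]$, and $I\in\mathcal{I}_2$ iff $I'_{2,i}\in\mathcal{I}'_2$ for all $i\in[W]$. A common independent set is a set independent in both matroids; its weight is the sum of element weights. *)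

theory Defs
  imports Main
begin

locale matroid =
  fixes carrier :: "'a set" and indep :: "'a set set"
  assumes finite_carrier: "finite carrier"
    and indep_subset: "X \<in> indep \<Longrightarrow> X \<subseteq> carrier"
    and empty_indep: "{} \<in> indep"
    and indep_down: "X \<in> indep \<Longrightarrow> Y \<subseteq> X \<Longrightarrow> Y \<in> indep"
    and augment: "X \<in> indep \<Longrightarrow> Y \<in> indep \<Longrightarrow> card X < card Y \<Longrightarrow>
                    \<exists>y \<in> Y - X. insert y X \<in> indep"

text \<open>The pair \<open>(e, i)\<close> with \<open>1 \<le> i \<le> w e\<close> represents the copy \<open>e\<^sub>i\<close> of \<open>e\<close>.\<close>

definition unfold_ground :: "'a set \<Rightarrow> ('a \<Rightarrow> nat) \<Rightarrow> ('a \<times> nat) set" where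
  "unfold_ground N w = {(e, i). e \<in> N \<and> 1 \<le> i \<and> i \<le> w e}"

definition layer1 :: "'a set \<Rightarrow> ('a \<times> nat) set \<Rightarrow> nat \<Rightarrow> 'a set" where
  "layer1 N I i = {e \<in> N. (e, i) \<in> I}"

text \<open>For \<open>i > w e\<close> there is no copy of \<open>e\<close> with index \<open>w e - i + 1 \<le> 0\<close>; the guard \<open>i \<le> w e\<close>
  is needed because subtraction on \<open>nat\<close> would otherwise turn this index into \<open>1\<close>.\<close>

definition layer2 :: "'a set \<Rightarrow> ('a \<Rightarrow> nat) \<Rightarrow> ('a \<times> nat) set \<Rightarrow> nat \<Rightarrow> 'a set" where
  "layer2 N w I i = {e \<in> N. i \<le> w e \<and> (e, w e - i + 1) \<in> I}"

definition unfold_indep1 ::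
    "'a set \<Rightarrow> ('a \<Rightarrow> nat) \<Rightarrow> nat \<Rightarrow> 'a set set \<Rightarrow> ('a \<times> nat) set set" where
  "unfold_indep1 N w W \<I> =
     {I. I \<subseteq> unfold_ground N w \<and> (\<forall>i \<in> {1..W}. layer1 N I i \<in> \<I>)}"

definition unfold_indep2 ::
    "'a set \<Rightarrow> ('a \<Rightarrow> nat) \<Rightarrow> nat \<Rightarrow> 'a set set \<Rightarrow> ('a \<times> nat) set set" where
  "unfold_indep2 N w W \<I> =
     {I. I \<subseteq> unfold_ground N w \<and> (\<forall>i \<in> {1..W}. layer2 N w I i \<in> \<I>)}"

definition max_weight_common :: "('a \<Rightarrow> nat) \<Rightarrow> 'a set set \<Rightarrow> 'a set set \<Rightarrow> nat" where
  "max_weight_common w \<I>\<^sub>1 \<I>\<^sub>2 = Max {\<Sum>e\<in>I. w e | I. I \<in> \<I>\<^sub>1 \<and> I \<in> \<I>\<^sub>2}"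

definition max_card_common :: "'a set set \<Rightarrow> 'a set set \<Rightarrow> nat" where
  "max_card_common \<I>\<^sub>1 \<I>\<^sub>2 = Max {card I | I. I \<in> \<I>\<^sub>1 \<and> I \<in> \<I>\<^sub>2}"

end

theory Submission imports Defs begin

text \<open>
  Call \<open>w = u + (w - u)\<close> with \<open>0 \<le> u \<le> w\<close> a splitting of \<open>w\<close>, and let \<open>\<Phi>(u)\<close> be the sum over
  \<open>i \<ge> 1\<close> of \<open>r\<^sub>1{u \<ge> i} + r\<^sub>2{w - u \<ge> i}\<close>. A copy \<open>e\<^sub>i\<close> satisfies either \<open>i \<le> u e\<close> or
  \<open>w e - i + 1 \<le> w e - u e\<close>, so every common independent set of the unfolded instance has at most
  \<open>\<Phi>(u)\<close> elements. Conversely, let \<open>u\<close> minimise \<open>\<Phi>\<close>. Moving one unit of weight on a set \<open>X\<close> from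
  one side to the other changes \<open>\<Phi>\<close> by ranks of \<open>X\<close> in the graded matroids (direct sums of
  the minors between consecutive level sets), so minimality is a family of rank inequalities. By the
  unweighted matroid intersection theorem these yield a common independent set of the graded
  matroids that spans all positive level sets of \<open>u\<close> and of \<open>w - u\<close>, and its weight is \<open>\<Phi>(u)\<close>.
\<close>

section \<open>Rank functions and matroid intersection\<close>

text \<open>Finite sets whose rank equals their cardinality stand for the independent sets, so no
  family of sets has to be carried through contractions and direct sums. Integer values make
  differences of ranks exact.\<close>

locale rank_function =
  fixes r :: "'a set \<Rightarrow> int"
  assumes rank_empty: "r {} = 0"
    and rank_mono: "X \<subseteq> Y \<Longrightarrow> r X \<le> r Y"
    and rank_insert_le: "r (insert x X) \<le> r X + 1"
    and rank_submodular: "r (X \<union> Y) + r (X \<inter> Y) \<le> r X + r Y"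
begin

lemma rank_nonneg: "0 \<le> r X"
  using rank_mono[of "{}" X] rank_empty by simp

lemma rank_le_card: "finite X \<Longrightarrow> r X \<le> int (card X)"
proof (induction X rule: finite_induct)
  case empty
  then show ?case by (simp add: rank_empty)
next
  case (insert x X)
  then show ?case using rank_insert_le[of x X] by simp
qed

lemma rank_Un_le: "r (X \<union> Y) \<le> r X + r Y"
  using rank_submodular[of X Y] rank_nonneg[of "X \<inter> Y"] by linarith

text \<open>Independence passes to subsets: discarding \<open>Y - X\<close> costs at most
  \<open>card (Y - X)\<close> in rank.\<close>

lemma rank_subset_eq_card:
  assumes "finite Y" "X \<subseteq> Y" "r Y = int (card Y)"
  shows "r X = int (card X)"
proof -
  have "finite X" using assms finite_subset by blast
  have "r Y \<le> r X + r (Y - X)"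
    using rank_Un_le[of X "Y - X"] assms(2) by (simp add: Un_absorb1)
  moreover have "r (Y - X) \<le> int (card (Y - X))"
    using assms(1) by (intro rank_le_card) simp
  moreover have "int (card Y) = int (card X) + int (card (Y - X))"
    using assms(1,2) \<open>finite X\<close> by (simp add: card_Diff_subset card_mono of_nat_diff)
  ultimately show ?thesis
    using rank_le_card[OF \<open>finite X\<close>] assms(3) by linarith
qed

section \<open>Contraction, truncation and direct sum of rank functions\<close>

lemma rank_function_contract: "rank_function (\<lambda>X. r (insert e X) - r {e})"
proof
  fix X Y :: "'a set" and x
  show "r (insert e (X \<union> Y)) - r {e} + (r (insert e (X \<inter> Y)) - r {e})
      \<le> r (insert e X) - r {e} + (r (insert e Y) - r {e})"
    using rank_submodular[of "insert e X" "insert e Y"] by simp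
  show "r (insert e (insert x X)) - r {e} \<le> r (insert e X) - r {e} + 1"
    using rank_insert_le[of x "insert e X"] by (simp add: insert_commute)
  show "X \<subseteq> Y \<Longrightarrow> r (insert e X) - r {e} \<le> r (insert e Y) - r {e}"
    using rank_mono[of "insert e X" "insert e Y"] by auto
qed simp

text \<open>If \<open>X\<close> or \<open>Y\<close> reaches the cap, so does the union, and
  monotonicity suffices for submodularity; if neither does, the cap can only lower the left-hand
  side.\<close>

lemma rank_function_truncate:
  assumes "0 \<le> c"
  shows "rank_function (\<lambda>X. min c (r X))"
proof
  fix X Y :: "'a set" and x
  show "min c (r (X \<union> Y)) + min c (r (X \<inter> Y)) \<le> min c (r X) + min c (r Y)"
    using rank_submodular[of X Y] rank_mono[of X "X \<union> Y"] rank_mono[of Y "X \<union> Y"]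
      rank_mono[of "X \<inter> Y" X] rank_mono[of "X \<inter> Y" Y] by (auto simp: min_def)
  show "min c (r (insert x X)) \<le> min c (r X) + 1"
    using rank_insert_le[of x X] by linarith
  show "X \<subseteq> Y \<Longrightarrow> min c (r X) \<le> min c (r Y)"
    using rank_mono[of X Y] by linarith
  show "min c (r {}) = 0" using assms rank_empty by simp
qed

end

lemma rank_function_direct_sum:
  assumes "rank_function p" "rank_function q"
  shows "rank_function (\<lambda>X. p (X - Z) + q (X \<inter> Z))"
proof -
  interpret p: rank_function p by fact
  interpret q: rank_function q by fact
  show ?thesis
  proof
    fix X Y :: "'a set" and x
    have "(X - Z) \<union> (Y - Z) = X \<union> Y - Z" "(X - Z) \<inter> (Y - Z) = X \<inter> Y - Z"
      "X \<inter> Z \<union> Y \<inter> Z = (X \<union> Y) \<inter> Z" "X \<inter> Z \<inter> (Y \<inter> Z) = X \<inter> Y \<inter> Z" by blast+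
    then show "p (X \<union> Y - Z) + q ((X \<union> Y) \<inter> Z) + (p (X \<inter> Y - Z) + q (X \<inter> Y \<inter> Z))
        \<le> p (X - Z) + q (X \<inter> Z) + (p (Y - Z) + q (Y \<inter> Z))"
      using p.rank_submodular[of "X - Z" "Y - Z"] q.rank_submodular[of "X \<inter> Z" "Y \<inter> Z"]
      by simp
    show "p (insert x X - Z) + q (insert x X \<inter> Z) \<le> p (X - Z) + q (X \<inter> Z) + 1"
      using p.rank_insert_le[of x "X - Z"] q.rank_insert_le[of x "X \<inter> Z"]
      by (cases "x \<in> Z") (auto simp: insert_Diff_if)
    show "X \<subseteq> Y \<Longrightarrow> p (X - Z) + q (X \<inter> Z) \<le> p (Y - Z) + q (Y \<inter> Z)"
      by (intro add_mono p.rank_mono q.rank_mono) auto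
  qed (simp add: p.rank_empty q.rank_empty)
qed

text \<open>The hard direction of Edmonds' theorem, by induction on the ground set: either
  \<open>e\<close> can be deleted with all cuts still at least \<open>k\<close>, or \<open>e\<close>
  is contracted and the bound drops to \<open>k - 1\<close>.\<close>

theorem matroid_intersection:
  fixes p q :: "'a set \<Rightarrow> int"
  assumes "finite E" "rank_function p" "rank_function q"
    and "\<And>X. X \<subseteq> E \<Longrightarrow> k \<le> p X + q (E - X)"
  shows "\<exists>J \<subseteq> E. p J = int (card J) \<and> q J = int (card J) \<and> k \<le> int (card J)"
  using assms
proof (induction E arbitrary: p q k rule: finite_induct)
  case empty
  interpret p: rank_function p by fact
  interpret q: rank_function q by fact
  show ?case using empty(3)[of "{}"] by (simp add: p.rank_empty q.rank_empty)
next
  case (insert e E)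
  interpret p: rank_function p by fact
  interpret q: rank_function q by fact
  note cut = insert.prems(3)
  show ?case
  proof (cases "\<forall>X \<subseteq> E. k \<le> p X + q (E - X)")
    case True
    then have "\<exists>J \<subseteq> E. p J = int (card J) \<and> q J = int (card J) \<and> k \<le> int (card J)"
      using insert.IH insert.prems by blast
    then show ?thesis by blast
  next
    case False
    \<comment> \<open>\<open>A\<close> gives a cut of \<open>E\<close> below \<open>k\<close>.
      Adding \<open>e\<close> to either side of it restores \<open>k\<close>, so \<open>e\<close> is
      a loop of neither matroid.\<close>
    then obtain A where A: "A \<subseteq> E" "p A + q (E - A) < k" by (meson not_le)
    have eA: "insert e E - insert e A = E - A" "insert e E - A = insert e (E - A)"
      using A(1) insert.hyps by auto
    have p1: "p {e} = 1"
    proof -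
      have "k \<le> p (insert e A) + q (E - A)" using cut[of "insert e A"] A(1) eA by auto
      then have "0 < p {e}" using A(2) p.rank_Un_le[of "{e}" A] by simp
      then show ?thesis using p.rank_le_card[of "{e}"] by simp
    qed
    have q1: "q {e} = 1"
    proof -
      have "k \<le> p A + q (insert e (E - A))" using cut[of A] A(1) eA by auto
      then have "0 < q {e}" using A(2) q.rank_Un_le[of "{e}" "E - A"] by simp
      then show ?thesis using q.rank_le_card[of "{e}"] by simp
    qed
    \<comment> \<open>Uncrossing the cut of \<open>A\<close> with that of \<open>B\<close>: of the
      two resulting cuts of \<open>insert e E\<close>, one has \<open>e\<close> on the
      \<open>p\<close> side and one on the \<open>q\<close> side, so they sum to at least
      \<open>2k\<close>. By integrality the cut of \<open>A\<close> is at most \<open>k - 1\<close>;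
      this leaves \<open>k + 1\<close>, minus the two ranks of \<open>{e}\<close>.\<close>
    have "k - 1 \<le> (p (insert e B) - p {e}) + (q (insert e (E - B)) - q {e})" if B: "B \<subseteq> E" for B
    proof -
      have "p (insert e (A \<union> B)) + p (A \<inter> B) \<le> p A + p (insert e B)"
      proof -
        have "A \<union> insert e B = insert e (A \<union> B)" by blast
        moreover have "A \<inter> insert e B = A \<inter> B" using A(1) insert.hyps by blast
        ultimately show ?thesis using p.rank_submodular[of A "insert e B"] by simp
      qed
      moreover have "q (insert e (E - A \<inter> B)) + q (E - (A \<union> B)) \<le> q (E - A) + q (insert e (E - B))"
      proof -
        have "(E - A) \<union> insert e (E - B) = insert e (E - A \<inter> B)" by blast
        moreover have "(E - A) \<inter> insert e (E - B) = E - (A \<union> B)" using insert.hyps by blast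
        ultimately show ?thesis using q.rank_submodular[of "E - A" "insert e (E - B)"] by simp
      qed
      moreover have "k \<le> p (insert e (A \<union> B)) + q (E - (A \<union> B))"
      proof -
        have "insert e E - insert e (A \<union> B) = E - (A \<union> B)" using insert.hyps by blast
        then show ?thesis using cut[of "insert e (A \<union> B)"] A(1) B by auto
      qed
      moreover have "k \<le> p (A \<inter> B) + q (insert e (E - A \<inter> B))"
      proof -
        have "insert e E - A \<inter> B = insert e (E - A \<inter> B)" using insert.hyps A(1) by blast
        then show ?thesis using cut[of "A \<inter> B"] A(1) by auto
      qed
      ultimately show ?thesis using A(2) p1 q1 by linarith
    qed
    from insert.IH[OF p.rank_function_contract[of e] q.rank_function_contract[of e] this]
    obtain J where J: "J \<subseteq> E" "p (insert e J) - p {e} = int (card J)"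
      "q (insert e J) - q {e} = int (card J)" "k - 1 \<le> int (card J)" by blast
    have "card (insert e J) = Suc (card J)"
      using J(1) insert.hyps finite_subset by (subst card_insert_disjoint) auto
    then show ?thesis using J p1 q1 by (intro exI[of _ "insert e J"]) auto
  qed
qed

text \<open>
  The first matroid is a direct sum of its restrictions to \<open>Z\<^sub>1\<close> and its complement, the second one
  likewise for \<open>Z\<^sub>2\<close>. Truncating the summands on \<open>Z\<^sub>1\<close> and \<open>Z\<^sub>2\<close> so that both matroids get the
  rank \<open>K\<close> of a minimum cut forces every common basis to span the two complements.
\<close>

lemma common_independent_spanning_complements:
  fixes p q :: "'a set \<Rightarrow> int"
  assumes fin: "finite E" and "rank_function p" and "rank_function q"
    and psep: "\<And>X. p X = p (X - Z\<^sub>1) + p (X \<inter> Z\<^sub>1)"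
    and qsep: "\<And>X. q X = q (X - Z\<^sub>2) + q (X \<inter> Z\<^sub>2)"
    and H1: "\<And>X. X \<subseteq> E - Z\<^sub>2 \<Longrightarrow> q (E - Z\<^sub>2) \<le> p X + q (E - Z\<^sub>2 - X)"
    and H2: "\<And>X. X \<subseteq> E - Z\<^sub>1 \<Longrightarrow> p (E - Z\<^sub>1) \<le> q X + p (E - Z\<^sub>1 - X)"
  shows "\<exists>J \<subseteq> E. p J = int (card J) \<and> q J = int (card J) \<and>
           p (E - Z\<^sub>1) \<le> int (card (J - Z\<^sub>1)) \<and> q (E - Z\<^sub>2) \<le> int (card (J - Z\<^sub>2))"
proof -
  interpret p: rank_function p by fact
  interpret q: rank_function q by fact
  define a where "a = p (E - Z\<^sub>1)"
  define b where "b = q (E - Z\<^sub>2)"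
  \<comment> \<open>Monotonicity extends the hypothesis from complementary parts to arbitrary
    covers.\<close>
  have H1': "b \<le> p X + q Y" if "E - Z\<^sub>2 \<subseteq> X \<union> Y" for X Y
    using H1[of "X \<inter> (E - Z\<^sub>2)"] p.rank_mono[of "X \<inter> (E - Z\<^sub>2)" X]
      q.rank_mono[of "E - Z\<^sub>2 - X \<inter> (E - Z\<^sub>2)" Y] that unfolding b_def by fastforce
  have H2': "a \<le> p X + q Y" if "E - Z\<^sub>1 \<subseteq> X \<union> Y" for X Y
    using H2[of "Y \<inter> (E - Z\<^sub>1)"] q.rank_mono[of "Y \<inter> (E - Z\<^sub>1)" Y]
      p.rank_mono[of "E - Z\<^sub>1 - Y \<inter> (E - Z\<^sub>1)" X] that unfolding a_def by fastforce
  define cuts where "cuts = (\<lambda>X. p X + q (E - X)) ` Pow E"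
  have "finite cuts" "cuts \<noteq> {}" using fin by (auto simp: cuts_def)
  define K where "K = Min cuts"
  have K_le: "K \<le> p X + q (E - X)" if "X \<subseteq> E" for X
    using that \<open>finite cuts\<close> unfolding K_def cuts_def by (intro Min_le) auto
  obtain Y where Y: "Y \<subseteq> E" "K = p Y + q (E - Y)"
    using Min_in[OF \<open>finite cuts\<close> \<open>cuts \<noteq> {}\<close>] unfolding K_def cuts_def by auto
  have "a \<le> K" unfolding Y(2) by (rule H2') auto
  have "b \<le> K" unfolding Y(2) by (rule H1') auto
  \<comment> \<open>Uncross \<open>X\<close> with the minimum cut \<open>Y\<close> outside
    \<open>Z\<^sub>1\<close> and \<open>Z\<^sub>2\<close>. Attaching
    \<open>Y \<inter> Z\<^sub>1\<close> and \<open>(E - Y) \<inter> Z\<^sub>2\<close> to the two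
    intersections produces the covers that \<open>H1'\<close> and \<open>H2'\<close> need;
    separability detaches these parts again, and they complete \<open>K\<close>.\<close>
  have uncross: "a + b \<le> p (X - Z\<^sub>1) + q (E - X - Z\<^sub>2) + K" if "X \<subseteq> E" for X
  proof -
    have diff: "A - Z \<union> (B - Z) = A \<union> B - Z" "(A - Z) \<inter> (B - Z) = A \<inter> B - Z" for A B Z :: "'a set"
      by blast+
    have "p ((X \<union> Y) - Z\<^sub>1) + p (X \<inter> Y - Z\<^sub>1) \<le> p (X - Z\<^sub>1) + p (Y - Z\<^sub>1)"
      using p.rank_submodular[of "X - Z\<^sub>1" "Y - Z\<^sub>1"] by (simp only: diff)
    moreover have "q (((E - X) \<union> (E - Y)) - Z\<^sub>2) + q ((E - X) \<inter> (E - Y) - Z\<^sub>2)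
        \<le> q (E - X - Z\<^sub>2) + q (E - Y - Z\<^sub>2)"
      using q.rank_submodular[of "E - X - Z\<^sub>2" "E - Y - Z\<^sub>2"] by (simp only: diff)
    moreover have "p ((X \<inter> Y - Z\<^sub>1) \<union> (Y \<inter> Z\<^sub>1)) = p (X \<inter> Y - Z\<^sub>1) + p (Y \<inter> Z\<^sub>1)"
    proof -
      have "(X \<inter> Y - Z\<^sub>1) \<union> (Y \<inter> Z\<^sub>1) - Z\<^sub>1 = X \<inter> Y - Z\<^sub>1"
        "((X \<inter> Y - Z\<^sub>1) \<union> (Y \<inter> Z\<^sub>1)) \<inter> Z\<^sub>1 = Y \<inter> Z\<^sub>1" by blast+
      then show ?thesis using psep by metis
    qed
    moreover have "q (((E - X) \<inter> (E - Y) - Z\<^sub>2) \<union> ((E - Y) \<inter> Z\<^sub>2))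
        = q ((E - X) \<inter> (E - Y) - Z\<^sub>2) + q ((E - Y) \<inter> Z\<^sub>2)"
    proof -
      have "((E - X) \<inter> (E - Y) - Z\<^sub>2) \<union> ((E - Y) \<inter> Z\<^sub>2) - Z\<^sub>2 = (E - X) \<inter> (E - Y) - Z\<^sub>2"
        "(((E - X) \<inter> (E - Y) - Z\<^sub>2) \<union> ((E - Y) \<inter> Z\<^sub>2)) \<inter> Z\<^sub>2 = (E - Y) \<inter> Z\<^sub>2" by blast+
      then show ?thesis using qsep by metis
    qed
    moreover have "b \<le> p ((X \<inter> Y - Z\<^sub>1) \<union> (Y \<inter> Z\<^sub>1)) + q (((E - X) \<union> (E - Y)) - Z\<^sub>2)"
      by (rule H1') blast
    moreover have "a \<le> p ((X \<union> Y) - Z\<^sub>1) + q (((E - X) \<inter> (E - Y) - Z\<^sub>2) \<union> ((E - Y) \<inter> Z\<^sub>2))"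
      by (rule H2') blast
    moreover have "K = p (Y - Z\<^sub>1) + p (Y \<inter> Z\<^sub>1) + q (E - Y - Z\<^sub>2) + q ((E - Y) \<inter> Z\<^sub>2)"
      using Y(2) psep[of Y] qsep[of "E - Y"] by simp
    ultimately show ?thesis by linarith
  qed
  \<comment> \<open>The capped summand contributes at most \<open>K - a\<close> (resp.
    \<open>K - b\<close>), so a common independent set of size \<open>K\<close> has rank at least
    \<open>a\<close> outside \<open>Z\<^sub>1\<close> and at least \<open>b\<close> outside
    \<open>Z\<^sub>2\<close>.\<close>
  define p' where "p' = (\<lambda>X. p (X - Z\<^sub>1) + min (K - a) (p (X \<inter> Z\<^sub>1)))"
  define q' where "q' = (\<lambda>X. q (X - Z\<^sub>2) + min (K - b) (q (X \<inter> Z\<^sub>2)))"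
  have "rank_function p'" unfolding p'_def
    using \<open>a \<le> K\<close> by (intro rank_function_direct_sum p.rank_function_truncate assms) simp
  have "rank_function q'" unfolding q'_def
    using \<open>b \<le> K\<close> by (intro rank_function_direct_sum q.rank_function_truncate assms) simp
  \<comment> \<open>Four cases for the two minima: no cap active is \<open>K_le\<close>, one cap
    active is \<open>H2'\<close> or \<open>H1'\<close>, both active is
    \<open>uncross\<close>.\<close>
  have "K \<le> p' X + q' (E - X)" if "X \<subseteq> E" for X
  proof -
    have "a \<le> p (X - Z\<^sub>1) + q (E - X)" by (rule H2') auto
    moreover have "b \<le> p X + q (E - X - Z\<^sub>2)" by (rule H1') auto
    ultimately show ?thesis
      using K_le[OF that] uncross[OF that] psep[of X] qsep[of "E - X"]
      unfolding p'_def q'_def by linarith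
  qed
  from matroid_intersection[OF fin \<open>rank_function p'\<close> \<open>rank_function q'\<close> this]
  obtain J where J: "J \<subseteq> E" "p' J = int (card J)" "q' J = int (card J)" "K \<le> int (card J)" by blast
  have "finite J" using J(1) fin finite_subset by blast
  have "p' J \<le> p J" "q' J \<le> q J" unfolding p'_def q'_def using psep[of J] qsep[of J] by linarith+
  then have pq: "p J = int (card J)" "q J = int (card J)"
    using J p.rank_le_card[OF \<open>finite J\<close>] q.rank_le_card[OF \<open>finite J\<close>] by linarith+
  have "p (J - Z\<^sub>1) \<ge> a" "q (J - Z\<^sub>2) \<ge> b" using J unfolding p'_def q'_def by linarith+
  moreover have "p (J - Z\<^sub>1) \<le> int (card (J - Z\<^sub>1))" "q (J - Z\<^sub>2) \<le> int (card (J - Z\<^sub>2))"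
    using \<open>finite J\<close> by (auto intro: p.rank_le_card q.rank_le_card)
  ultimately show ?thesis using pq J(1) unfolding a_def b_def by (intro exI[of _ J]) linarith
qed

section \<open>Level sets and the graded matroid\<close>

definition upper_level :: "'a set \<Rightarrow> ('a \<Rightarrow> nat) \<Rightarrow> nat \<Rightarrow> 'a set" where
  "upper_level E v i = {e \<in> E. i \<le> v e}"

definition level :: "'a set \<Rightarrow> ('a \<Rightarrow> nat) \<Rightarrow> nat \<Rightarrow> 'a set" where
  "level E v i = {e \<in> E. v e = i}"

text \<open>One of the two halves of the objective \<Phi>. If \<open>v\<close> is at most
  \<open>W\<close> on \<open>E\<close>, thresholds above \<open>W\<close> would only add the rank of
  the empty set.\<close>

definition level_rank_sum :: "('a set \<Rightarrow> int) \<Rightarrow> 'a set \<Rightarrow> nat \<Rightarrow> ('a \<Rightarrow> nat) \<Rightarrow> int" where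
  "level_rank_sum r E W v = (\<Sum>i<W. r (upper_level E v (Suc i)))"

text \<open>The rank of \<open>X\<close> in a minor: contract everything above level
  \<open>i\<close> and restrict to level \<open>i\<close>.\<close>

definition graded_term :: "('a set \<Rightarrow> int) \<Rightarrow> 'a set \<Rightarrow> ('a \<Rightarrow> nat) \<Rightarrow> nat \<Rightarrow> 'a set \<Rightarrow> int" where
  "graded_term r E v i X =
     r (upper_level E v (Suc i) \<union> X \<inter> level E v i) - r (upper_level E v (Suc i))"

text \<open>Level 0 is included because its elements can still be raised; it takes the part of
  \<open>Z\<^sub>1\<close> and \<open>Z\<^sub>2\<close> in the intersection lemma.\<close>

definition graded_rank :: "('a set \<Rightarrow> int) \<Rightarrow> 'a set \<Rightarrow> nat \<Rightarrow> ('a \<Rightarrow> nat) \<Rightarrow> 'a set \<Rightarrow> int" where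
  "graded_rank r E W v X = (\<Sum>i\<le>W. graded_term r E v i X)"

context rank_function
begin

lemma graded_term_nonneg: "0 \<le> graded_term r E v i X"
  unfolding graded_term_def using rank_mono[of "upper_level E v (Suc i)"] by simp

lemma graded_term_cong:
  "X \<inter> level E v i = Y \<inter> level E v i \<Longrightarrow> graded_term r E v i X = graded_term r E v i Y"
  by (simp add: graded_term_def)

lemma graded_term_disjoint: "X \<inter> level E v i = {} \<Longrightarrow> graded_term r E v i X = 0"
  by (simp add: graded_term_def)

lemma rank_function_graded_rank: "rank_function (graded_rank r E W v)"
proof
  fix X Y :: "'a set" and x
  show "graded_rank r E W v {} = 0" by (simp add: graded_rank_def graded_term_def)
  show "graded_rank r E W v X \<le> graded_rank r E W v Y" if "X \<subseteq> Y"
    unfolding graded_rank_def graded_term_def using that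
    by (intro sum_mono diff_right_mono rank_mono) auto
  show "graded_rank r E W v (X \<union> Y) + graded_rank r E W v (X \<inter> Y)
      \<le> graded_rank r E W v X + graded_rank r E W v Y"
    unfolding graded_rank_def sum.distrib[symmetric]
  proof (rule sum_mono)
    fix i
    let ?U = "upper_level E v (Suc i)" and ?L = "level E v i"
    have "(?U \<union> X \<inter> ?L) \<union> (?U \<union> Y \<inter> ?L) = ?U \<union> (X \<union> Y) \<inter> ?L"
      "(?U \<union> X \<inter> ?L) \<inter> (?U \<union> Y \<inter> ?L) = ?U \<union> (X \<inter> Y) \<inter> ?L" by blast+
    then show "graded_term r E v i (X \<union> Y) + graded_term r E v i (X \<inter> Y)
        \<le> graded_term r E v i X + graded_term r E v i Y"
      using rank_submodular[of "?U \<union> X \<inter> ?L" "?U \<union> Y \<inter> ?L"] unfolding graded_term_def by simp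
  qed
  \<comment> \<open>Only the summand of the level \<open>v x\<close> can grow, so the total grows by
    at most one.\<close>
  have term_insert: "graded_term r E v i (insert x X) \<le> graded_term r E v i X + (if i = v x then 1 else 0)"
    for i
  proof (cases "x \<in> level E v i")
    case True
    then have "v x = i" by (simp add: level_def)
    then show ?thesis
      using rank_insert_le[of x "upper_level E v (Suc i) \<union> X \<inter> level E v i"] True
      by (simp add: graded_term_def)
  next
    case False
    then have "graded_term r E v i (insert x X) = graded_term r E v i X"
      by (intro graded_term_cong) simp
    then show ?thesis by simp
  qed
  have "graded_rank r E W v (insert x X)
      \<le> (\<Sum>i\<le>W. graded_term r E v i X + (if i = v x then 1 else 0))"
    unfolding graded_rank_def by (intro sum_mono term_insert)
  also have "\<dots> = graded_rank r E W v X + (if v x \<le> W then 1 else 0)"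
    by (simp add: graded_rank_def sum.distrib)
  also have "\<dots> \<le> graded_rank r E W v X + 1" by simp
  finally show "graded_rank r E W v (insert x X) \<le> graded_rank r E W v X + 1" .
qed

lemma graded_rank_separable:
  "graded_rank r E W v X
     = graded_rank r E W v (X - level E v 0) + graded_rank r E W v (X \<inter> level E v 0)"
  unfolding graded_rank_def sum.distrib[symmetric]
proof (rule sum.cong[OF refl])
  fix i
  show "graded_term r E v i X
      = graded_term r E v i (X - level E v 0) + graded_term r E v i (X \<inter> level E v 0)"
  proof (cases "i = 0")
    case True
    then show ?thesis
      using graded_term_disjoint[of "X - level E v 0" E v 0]
        graded_term_cong[of "X \<inter> level E v 0" E v 0 X] by auto
  next
    case False
    then have "level E v 0 \<inter> level E v i = {}" by (auto simp: level_def)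
    then have "graded_term r E v i (X - level E v 0) = graded_term r E v i X"
      "graded_term r E v i (X \<inter> level E v 0) = 0"
      by (auto intro!: graded_term_cong graded_term_disjoint)
    then show ?thesis by simp
  qed
qed

text \<open>Diminishing returns: the elements of \<open>X\<close> below level \<open>b\<close> gain
  at least as much rank over the smaller set in which only \<open>X \<inter> level E v b\<close> is
  kept of level \<open>b\<close>. This is applied level by level.\<close>

lemma sum_graded_term_le:
  assumes "X \<subseteq> E"
  shows "(\<Sum>i<b. graded_term r E v i X)
    \<le> r ({e \<in> X. v e < b} \<union> upper_level E v b) - r (upper_level E v b)"
proof (induction b)
  case 0
  then show ?case by simp
next
  case (Suc b)
  let ?A = "{e \<in> X. v e < Suc b} \<union> upper_level E v (Suc b)" and ?U = "upper_level E v b"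
  have "?A \<union> ?U = {e \<in> X. v e < b} \<union> ?U" "?A \<inter> ?U = upper_level E v (Suc b) \<union> X \<inter> level E v b"
    using assms by (auto simp: upper_level_def level_def)
  then have "r ({e \<in> X. v e < b} \<union> ?U) + r (upper_level E v (Suc b) \<union> X \<inter> level E v b) \<le> r ?A + r ?U"
    using rank_submodular[of ?A ?U] by simp
  then show ?case using Suc by (simp add: graded_term_def)
qed

text \<open>At \<open>b = Suc W\<close> the upper level is empty. Hence independence in the graded
  matroid implies independence in the original one.\<close>

lemma graded_rank_le_rank:
  assumes "X \<subseteq> E" "\<forall>e\<in>E. v e \<le> W"
  shows "graded_rank r E W v X \<le> r X"
proof -
  have "upper_level E v (Suc W) = {}" "{e \<in> X. v e < Suc W} = X"
    using assms by (auto simp: upper_level_def less_Suc_eq_le)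
  then show ?thesis
    using sum_graded_term_le[OF assms(1), of v "Suc W"] rank_empty
    by (simp add: graded_rank_def lessThan_Suc_atMost del: sum.lessThan_Suc)
qed

text \<open>Only the levels from 1 to \<open>b - 1\<close> meet this set. The bound limits how much
  of an independent set can lie below the threshold \<open>b\<close>.\<close>

lemma graded_rank_between_levels:
  assumes "b \<le> W" "1 \<le> b"
  shows "graded_rank r E W v (upper_level E v 1 - upper_level E v b)
    \<le> r (upper_level E v 1) - r (upper_level E v b)"
proof -
  let ?X = "upper_level E v 1 - upper_level E v b"
  have "graded_rank r E W v ?X = (\<Sum>i<b. graded_term r E v i ?X)"
    unfolding graded_rank_def using assms(1)
    by (intro sum.mono_neutral_right) (auto intro!: graded_term_disjoint simp: level_def upper_level_def)
  also have "\<dots> \<le> r ({e \<in> ?X. v e < b} \<union> upper_level E v b) - r (upper_level E v b)"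
    by (rule sum_graded_term_le) (auto simp: upper_level_def)
  also have "{e \<in> ?X. v e < b} \<union> upper_level E v b = upper_level E v 1"
    using assms(2) by (auto simp: upper_level_def)
  finally show ?thesis .
qed

section \<open>Effect of moving one unit of weight\<close>

text \<open>Raising \<open>X\<close> adds \<open>X \<inter> level E v i\<close> to the upper level
  for \<open>Suc i\<close>, so this threshold gains one graded term. The only slack is level
  \<open>W\<close>, whose rise concerns a threshold outside the sum.\<close>

lemma level_rank_sum_increase:
  assumes "X \<subseteq> E"
  shows "level_rank_sum r E W (\<lambda>e. v e + of_bool (e \<in> X)) \<le> level_rank_sum r E W v + graded_rank r E W v X"
proof -
  have lev: "upper_level E (\<lambda>e. v e + of_bool (e \<in> X)) (Suc i)
      = upper_level E v (Suc i) \<union> X \<inter> level E v i" for i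
    using assms by (auto simp: upper_level_def level_def)
  have "level_rank_sum r E W (\<lambda>e. v e + of_bool (e \<in> X))
      = level_rank_sum r E W v + (\<Sum>i<W. graded_term r E v i X)"
    unfolding level_rank_sum_def lev by (simp add: graded_term_def sum_subtractf)
  moreover have "(\<Sum>i<W. graded_term r E v i X) \<le> graded_rank r E W v X"
    unfolding graded_rank_def lessThan_Suc_atMost[symmetric] by (simp add: graded_term_nonneg)
  ultimately show ?thesis by simp
qed

text \<open>Each new term is a graded term of the elements not lowered plus the rank of the next
  upper level; the shifted sum of the latter ranks misses only
  \<open>r (upper_level E v 1)\<close>.\<close>

lemma level_rank_sum_decrease:
  assumes "\<forall>e\<in>E. v e \<le> W"
  shows "level_rank_sum r E W (\<lambda>e. v e - of_bool (e \<in> X))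
    = level_rank_sum r E W v + graded_rank r E W v (E - level E v 0 - X) - r (upper_level E v 1)"
proof -
  let ?Y = "E - level E v 0 - X" and ?s = "\<lambda>i. r (upper_level E v (Suc i))"
  \<comment> \<open>Truncated subtraction keeps the value 0 at 0, below every threshold
    \<open>Suc i\<close>.\<close>
  have lev: "upper_level E (\<lambda>e. v e - of_bool (e \<in> X)) (Suc i)
      = upper_level E v (Suc (Suc i)) \<union> ?Y \<inter> level E v (Suc i)" for i
    by (auto simp: upper_level_def level_def of_bool_def split: if_splits)
  have "graded_term r E v 0 ?Y = 0" by (rule graded_term_disjoint) auto
  then have "graded_rank r E W v ?Y = (\<Sum>i<W. graded_term r E v (Suc i) ?Y)"
    unfolding graded_rank_def lessThan_Suc_atMost[symmetric] by (subst sum.lessThan_Suc_shift) simp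
  also have "\<dots> = level_rank_sum r E W (\<lambda>e. v e - of_bool (e \<in> X)) - (\<Sum>i<W. ?s (Suc i))"
    unfolding level_rank_sum_def lev by (simp add: graded_term_def sum_subtractf)
  also have "(\<Sum>i<W. ?s (Suc i)) = level_rank_sum r E W v - ?s 0"
  proof -
    have "upper_level E v (Suc W) = {}" using assms by (force simp: upper_level_def)
    then have "(\<Sum>i<Suc W. ?s i) = level_rank_sum r E W v" by (simp add: level_rank_sum_def rank_empty)
    then show ?thesis using sum.lessThan_Suc_shift[of ?s W] by linarith
  qed
  finally show ?thesis by simp
qed

text \<open>Lowering the empty set changes nothing, so the two correction terms cancel.\<close>

lemma graded_rank_positive_level:
  assumes "\<forall>e\<in>E. v e \<le> W"
  shows "graded_rank r E W v (E - level E v 0) = r (upper_level E v 1)"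
  using level_rank_sum_decrease[OF assms, of "{}"] by simp

text \<open>A basis of the graded matroid on the positive levels spans each of the upper levels.\<close>

lemma weight_ge_level_rank_sum:
  assumes fin: "finite E" and v: "\<forall>e\<in>E. v e \<le> W" and J: "J \<subseteq> E"
    and indep: "graded_rank r E W v J = int (card J)"
    and span: "graded_rank r E W v (E - level E v 0) \<le> int (card (J - level E v 0))"
  shows "level_rank_sum r E W v \<le> int (\<Sum>e\<in>J. v e)"
proof -
  interpret g: rank_function "graded_rank r E W v" by (rule rank_function_graded_rank)
  have finJ: "finite J" using J fin finite_subset by blast
  \<comment> \<open>\<open>J\<close> has at least \<open>r (upper_level E v 1)\<close> elements of
    positive value; independence limits those of value at most \<open>i\<close>, and the rest must
    lie in the upper level.\<close>
  have bound: "r (upper_level E v (Suc i)) \<le> int (card (J \<inter> upper_level E v (Suc i)))" if "i < W" for i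
  proof -
    let ?U = "upper_level E v (Suc i)"
    let ?D = "upper_level E v 1 - ?U"
    have "graded_rank r E W v (J \<inter> ?D) = int (card (J \<inter> ?D))"
      by (rule g.rank_subset_eq_card[OF finJ _ indep]) simp
    moreover have "graded_rank r E W v (J \<inter> ?D) \<le> graded_rank r E W v ?D"
      by (rule g.rank_mono) simp
    ultimately have "int (card (J \<inter> ?D)) \<le> r (upper_level E v 1) - r ?U"
      using graded_rank_between_levels[of "Suc i" W E v] that by simp
    moreover have "card (J - level E v 0) = card (J \<inter> ?D) + card (J \<inter> ?U)"
    proof -
      have "J - level E v 0 = (J \<inter> ?D) \<union> (J \<inter> ?U)"
        using J by (auto simp: level_def upper_level_def)
      moreover have "(J \<inter> ?D) \<inter> (J \<inter> ?U) = {}" by blast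
      ultimately show ?thesis using finJ by (metis card_Un_disjoint finite_Int)
    qed
    ultimately show ?thesis using span graded_rank_positive_level[OF v] by simp
  qed
  \<comment> \<open>Double counting: \<open>v e\<close> is the number of thresholds from 1 to
    \<open>W\<close> that \<open>e\<close> reaches.\<close>
  have "(\<Sum>e\<in>J. v e) = (\<Sum>e\<in>J. \<Sum>i<W. of_bool (i < v e))"
  proof (rule sum.cong[OF refl])
    fix e assume "e \<in> J"
    then have "{..<W} \<inter> {i. i < v e} = {..<v e}" using J v by fastforce
    then show "v e = (\<Sum>i<W. of_bool (i < v e))" by simp
  qed
  also have "\<dots> = (\<Sum>i<W. \<Sum>e\<in>J. of_bool (i < v e))" by (rule sum.swap)
  also have "\<dots> = (\<Sum>i<W. card (J \<inter> upper_level E v (Suc i)))"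
  proof (rule sum.cong[OF refl])
    fix i
    have "J \<inter> {e. i < v e} = J \<inter> upper_level E v (Suc i)" using J by (auto simp: upper_level_def)
    then show "(\<Sum>e\<in>J. of_bool (i < v e)) = card (J \<inter> upper_level E v (Suc i))"
      using finJ by simp
  qed
  finally have "int (\<Sum>e\<in>J. v e) = (\<Sum>i<W. int (card (J \<inter> upper_level E v (Suc i))))" by simp
  then show ?thesis unfolding level_rank_sum_def using bound by (auto intro!: sum_mono)
qed

end

section \<open>Minimal splittings and their common independent sets\<close>

text \<open>Compare with moving one unit on \<open>X\<close> from \<open>v\<close> to
  \<open>u\<close>; elements with \<open>v e = 0\<close> have none to give. The result is the cut
  hypothesis of the intersection lemma for the zero level of \<open>v\<close>.\<close>

lemma splitting_local_optimality:
  assumes "rank_function r" "rank_function s"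
    and v: "\<forall>e\<in>E. v e \<le> W"
    and opt: "\<And>u' v'. (\<forall>e\<in>E. u' e + v' e = u e + v e) \<Longrightarrow>
      level_rank_sum r E W u + level_rank_sum s E W v \<le> level_rank_sum r E W u' + level_rank_sum s E W v'"
    and X: "X \<subseteq> E - level E v 0"
  shows "graded_rank s E W v (E - level E v 0)
    \<le> graded_rank r E W u X + graded_rank s E W v (E - level E v 0 - X)"
proof -
  interpret r: rank_function r by fact
  interpret s: rank_function s by fact
  have "level_rank_sum r E W u + level_rank_sum s E W v
    \<le> level_rank_sum r E W (\<lambda>e. u e + of_bool (e \<in> X)) + level_rank_sum s E W (\<lambda>e. v e - of_bool (e \<in> X))"
    using X by (intro opt) (auto simp: level_def)
  moreover have "X \<subseteq> E" using X by blast
  ultimately show ?thesis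
    using r.level_rank_sum_increase[of X E W u] s.level_rank_sum_decrease[OF v, of X]
      s.graded_rank_positive_level[OF v] by linarith
qed

theorem weight_splitting:
  fixes r s :: "'a set \<Rightarrow> int"
  assumes fin: "finite E" and "rank_function r" and "rank_function s" and w: "\<forall>e\<in>E. w e \<le> W"
  shows "\<exists>u J. (\<forall>e. u e \<le> w e) \<and> J \<subseteq> E \<and> r J = int (card J) \<and> s J = int (card J) \<and>
    level_rank_sum r E W u + level_rank_sum s E W (\<lambda>e. w e - u e) \<le> int (\<Sum>e\<in>J. w e)"
proof -
  interpret r: rank_function r by fact
  interpret s: rank_function s by fact
  define \<Phi> where "\<Phi> u = level_rank_sum r E W u + level_rank_sum s E W (\<lambda>e. w e - u e)" for u
  have \<Phi>_nonneg: "0 \<le> \<Phi> u" for u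
    unfolding \<Phi>_def level_rank_sum_def by (intro add_nonneg_nonneg sum_nonneg r.rank_nonneg s.rank_nonneg)
  \<comment> \<open>A minimiser exists because \<Phi> takes nonnegative integer values;
    \<open>w\<close> itself is an admissible candidate.\<close>
  have "\<exists>u. (\<forall>e. u e \<le> w e) \<and> (\<forall>u'. (\<forall>e. u' e \<le> w e) \<longrightarrow> nat (\<Phi> u) \<le> nat (\<Phi> u'))"
    by (rule ex_has_least_nat[of _ w]) simp
  then obtain u where u: "\<forall>e. u e \<le> w e" and "\<And>u'. (\<forall>e. u' e \<le> w e) \<Longrightarrow> nat (\<Phi> u) \<le> nat (\<Phi> u')"
    by blast
  then have min: "\<Phi> u \<le> \<Phi> u'" if "\<forall>e. u' e \<le> w e" for u'
    using that \<Phi>_nonneg[of u'] by (metis nat_le_eq_zle nat_mono_iff not_le order_le_less)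
  define v where "v e = w e - u e" for e
  have uW: "\<forall>e\<in>E. u e \<le> W" and vW: "\<forall>e\<in>E. v e \<le> W"
    using u w le_trans unfolding v_def by (blast, force)
  have opt: "level_rank_sum r E W u + level_rank_sum s E W v
      \<le> level_rank_sum r E W u' + level_rank_sum s E W v'"
    if *: "\<forall>e\<in>E. u' e + v' e = u e + v e" for u' v'
  proof -
    \<comment> \<open>A competitor is constrained only on \<open>E\<close>; setting it to 0
      elsewhere makes it admissible everywhere without changing any upper level.\<close>
    define u'' where "u'' e = (if e \<in> E then u' e else 0)" for e
    have split: "u' e + v' e = w e" if "e \<in> E" for e using * u that unfolding v_def by simp
    have "\<forall>e. u'' e \<le> w e" unfolding u''_def using split by (metis le_add1 le0)
    then have "\<Phi> u \<le> \<Phi> u''" by (rule min)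
    moreover have "upper_level E u'' i = upper_level E u' i" for i
      by (auto simp: upper_level_def u''_def)
    moreover have "upper_level E (\<lambda>e. w e - u'' e) i = upper_level E v' i" for i
      using split by (force simp: upper_level_def u''_def)
    ultimately show ?thesis unfolding \<Phi>_def level_rank_sum_def v_def by simp
  qed
  have opt': "level_rank_sum s E W v + level_rank_sum r E W u
      \<le> level_rank_sum s E W v' + level_rank_sum r E W u'"
    if "\<forall>e\<in>E. v' e + u' e = v e + u e" for v' u'
    using opt[of u' v'] that by (simp add: add.commute)
  have "\<exists>J \<subseteq> E. graded_rank r E W u J = int (card J) \<and> graded_rank s E W v J = int (card J) \<and>
      graded_rank r E W u (E - level E u 0) \<le> int (card (J - level E u 0)) \<and>
      graded_rank s E W v (E - level E v 0) \<le> int (card (J - level E v 0))"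
    by (rule common_independent_spanning_complements[OF fin r.rank_function_graded_rank
          s.rank_function_graded_rank r.graded_rank_separable s.graded_rank_separable
          splitting_local_optimality[OF assms(2,3) vW opt] splitting_local_optimality[OF assms(3,2) uW opt']])
  then obtain J where J: "J \<subseteq> E" "graded_rank r E W u J = int (card J)"
    "graded_rank s E W v J = int (card J)"
    "graded_rank r E W u (E - level E u 0) \<le> int (card (J - level E u 0))"
    "graded_rank s E W v (E - level E v 0) \<le> int (card (J - level E v 0))" by blast
  have finJ: "finite J" using J(1) fin finite_subset by blast
  have "r J = int (card J)"
    using r.graded_rank_le_rank[OF J(1) uW] r.rank_le_card[OF finJ] J(2) by linarith
  moreover have "s J = int (card J)"
    using s.graded_rank_le_rank[OF J(1) vW] s.rank_le_card[OF finJ] J(3) by linarith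
  moreover have "(\<Sum>e\<in>J. w e) = (\<Sum>e\<in>J. u e) + (\<Sum>e\<in>J. v e)"
    using u by (simp add: sum.distrib[symmetric] v_def)
  then have "level_rank_sum r E W u + level_rank_sum s E W v \<le> int (\<Sum>e\<in>J. w e)"
    using r.weight_ge_level_rank_sum[OF fin uW J(1,2,4)]
      s.weight_ge_level_rank_sum[OF fin vW J(1,3,5)] by simp
  ultimately show ?thesis using u J(1) unfolding v_def by blast
qed

section \<open>The rank function of a matroid\<close>

context matroid
begin

definition rank :: "'a set \<Rightarrow> nat" where
  "rank X = Max (card ` {I \<in> indep. I \<subseteq> X})"

lemma finite_indep: "finite indep"
  using finite_carrier indep_subset by (intro finite_subset[of indep "Pow carrier"]) auto

lemma indep_finite: "X \<in> indep \<Longrightarrow> finite X"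
  using finite_carrier indep_subset finite_subset by blast

lemma card_le_rank: "I \<in> indep \<Longrightarrow> I \<subseteq> X \<Longrightarrow> card I \<le> rank X"
  unfolding rank_def using finite_indep by (intro Max_ge) auto

lemma obtain_basis:
  obtains B where "B \<in> indep" "B \<subseteq> X" "card B = rank X"
proof -
  have "rank X \<in> card ` {I \<in> indep. I \<subseteq> X}"
    unfolding rank_def using finite_indep empty_indep by (intro Max_in) auto
  then show ?thesis using that by auto
qed

text \<open>A largest independent set between \<open>I\<close> and \<open>X\<close> has full rank,
  since otherwise a basis of \<open>X\<close> would augment it inside \<open>X\<close>.\<close>

lemma extend_to_basis:
  assumes "I \<in> indep" "I \<subseteq> X"
  obtains B where "B \<in> indep" "I \<subseteq> B" "B \<subseteq> X" "card B = rank X"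
proof -
  let ?P = "\<lambda>B. B \<in> indep \<and> I \<subseteq> B \<and> B \<subseteq> X"
  have "\<exists>B. ?P B \<and> (\<forall>B'. ?P B' \<longrightarrow> card B' \<le> card B)"
    using assms card_le_rank by (intro ex_has_greatest_nat[of _ I _ "Suc (rank X)"]) (auto simp: le_imp_less_Suc)
  then obtain B where B: "?P B" and max: "\<And>B'. ?P B' \<Longrightarrow> card B' \<le> card B" by blast
  obtain C where C: "C \<in> indep" "C \<subseteq> X" "card C = rank X" by (rule obtain_basis)
  have "\<not> card B < card C"
  proof
    assume "card B < card C"
    then obtain y where y: "y \<in> C - B" "insert y B \<in> indep" using augment B C(1) by blast
    then have "card (insert y B) \<le> card B" using B C(2) by (intro max) auto
    then show False using y(1) B indep_finite by simp
  qed
  then show ?thesis using that B C(3) card_le_rank[of B X] by force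
qed

lemma rank_function_rank: "rank_function (\<lambda>X. int (rank X))"
proof
  fix X Y :: "'a set" and x
  show "int (rank {}) = 0" by (rule obtain_basis[of "{}"]) auto
  show "int (rank X) \<le> int (rank Y)" if "X \<subseteq> Y"
  proof -
    obtain B where "B \<in> indep" "B \<subseteq> X" "card B = rank X" by (rule obtain_basis)
    then show ?thesis using that card_le_rank[of B Y] by simp
  qed
  show "int (rank (insert x X)) \<le> int (rank X) + 1"
  proof -
    obtain B where B: "B \<in> indep" "B \<subseteq> insert x X" "card B = rank (insert x X)" by (rule obtain_basis)
    have "card (B - {x}) \<le> rank X" using B by (intro card_le_rank indep_down[OF B(1)]) auto
    moreover have "card B \<le> card (B - {x}) + 1" using diff_card_le_card_Diff[of "{x}" B] by simp
    ultimately show ?thesis using B(3) by simp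
  qed
  show "int (rank (X \<union> Y)) + int (rank (X \<inter> Y)) \<le> int (rank X) + int (rank Y)"
  proof -
    \<comment> \<open>Extend a basis \<open>I\<close> of the intersection to a basis
      \<open>B\<close> of the union; counting \<open>B\<close> within \<open>X\<close> and within
      \<open>Y\<close> counts \<open>I\<close> twice.\<close>
    obtain I where I: "I \<in> indep" "I \<subseteq> X \<inter> Y" "card I = rank (X \<inter> Y)" by (rule obtain_basis)
    then have "I \<subseteq> X \<union> Y" by blast
    with I(1) obtain B where B: "B \<in> indep" "I \<subseteq> B" "B \<subseteq> X \<union> Y" "card B = rank (X \<union> Y)"
      by (rule extend_to_basis)
    have finB: "finite B" using B(1) by (rule indep_finite)
    have "card B + card I \<le> card B + card (B \<inter> X \<inter> (B \<inter> Y))"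
      using I(2) B(2) finB by (intro add_left_mono card_mono) auto
    also have "\<dots> = card (B \<inter> X) + card (B \<inter> Y)"
    proof -
      have "B \<inter> X \<union> B \<inter> Y = B" using B(3) by blast
      then show ?thesis using card_Un_Int[of "B \<inter> X" "B \<inter> Y"] finB by simp
    qed
    also have "\<dots> \<le> rank X + rank Y"
      by (intro add_mono card_le_rank indep_down[OF B(1)]) auto
    finally show ?thesis using I(3) B(4) by simp
  qed
qed

lemma indep_if_rank_eq_card:
  assumes "finite J" "rank J = card J"
  shows "J \<in> indep"
proof -
  obtain B where "B \<in> indep" "B \<subseteq> J" "card B = rank J" by (rule obtain_basis)
  then show ?thesis using assms card_subset_eq by metis
qed

end

section \<open>The unfolded instance\<close>

text \<open>Weak duality, for every splitting: copies up to index \<open>u e\<close> are charged to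
  layers of the first matroid, the others to layers of the second, and an independent set inside an
  upper level is no larger than its rank.\<close>

lemma unfolded_card_le_level_rank_sum:
  assumes "matroid N \<I>\<^sub>1" "matroid N \<I>\<^sub>2" and w: "\<forall>e\<in>N. w e \<le> W" and u: "\<forall>e. u e \<le> w e"
    and I: "I \<in> unfold_indep1 N w W \<I>\<^sub>1" "I \<in> unfold_indep2 N w W \<I>\<^sub>2"
  shows "int (card I) \<le> level_rank_sum (\<lambda>X. int (matroid.rank \<I>\<^sub>1 X)) N W u
    + level_rank_sum (\<lambda>X. int (matroid.rank \<I>\<^sub>2 X)) N W (\<lambda>e. w e - u e)"
proof -
  interpret M1: matroid N \<I>\<^sub>1 by fact
  interpret M2: matroid N \<I>\<^sub>2 by fact
  let ?U = "\<lambda>i. upper_level N u (Suc i)" and ?V = "\<lambda>i. upper_level N (\<lambda>e. w e - u e) (Suc i)"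
  let ?A = "\<lambda>i. layer1 N I (Suc i) \<inter> ?U i" and ?B = "\<lambda>i. layer2 N w I (Suc i) \<inter> ?V i"
  have sub: "I \<subseteq> unfold_ground N w" and A: "\<And>i. i < W \<Longrightarrow> layer1 N I (Suc i) \<in> \<I>\<^sub>1"
    and B: "\<And>i. i < W \<Longrightarrow> layer2 N w I (Suc i) \<in> \<I>\<^sub>2"
    using I unfolding unfold_indep1_def unfold_indep2_def by auto
  have fin: "finite (?A i)" "finite (?B i)" for i
    using M1.finite_carrier by (auto simp: layer1_def layer2_def)
  \<comment> \<open>Layer \<open>Suc i\<close> of the second matroid holds the copy with index
    \<open>w e - Suc i + 1\<close>, which is \<open>w e - i\<close> for
    \<open>Suc i \<le> w e\<close>.\<close>
  have "I \<subseteq> (\<Union>i<W. (\<lambda>e. (e, Suc i)) ` ?A i) \<union> (\<Union>i<W. (\<lambda>e. (e, w e - i)) ` ?B i)"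
  proof
    fix x assume x: "x \<in> I"
    then obtain e j where ej: "x = (e, j)" "e \<in> N" "1 \<le> j" "j \<le> w e"
      using sub by (auto simp: unfold_ground_def)
    have "w e \<le> W" using w ej(2) by blast
    show "x \<in> (\<Union>i<W. (\<lambda>e. (e, Suc i)) ` ?A i) \<union> (\<Union>i<W. (\<lambda>e. (e, w e - i)) ` ?B i)"
    proof (cases "j \<le> u e")
      case True
      have "e \<in> ?A (j - 1)" using x ej True by (simp add: layer1_def upper_level_def)
      moreover have "x = (e, Suc (j - 1))" "j - 1 < W" using ej \<open>w e \<le> W\<close> by auto
      ultimately show ?thesis by blast
    next
      case False
      have "e \<in> ?B (w e - j)"
        using x ej False by (auto simp: layer2_def upper_level_def Suc_diff_le)
      moreover have "x = (e, w e - (w e - j))" "w e - j < W" using ej \<open>w e \<le> W\<close> by auto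
      ultimately show ?thesis by blast
    qed
  qed
  then have "card I \<le> card ((\<Union>i<W. (\<lambda>e. (e, Suc i)) ` ?A i) \<union> (\<Union>i<W. (\<lambda>e. (e, w e - i)) ` ?B i))"
    using fin by (intro card_mono) auto
  also have "\<dots> \<le> card (\<Union>i<W. (\<lambda>e. (e, Suc i)) ` ?A i) + card (\<Union>i<W. (\<lambda>e. (e, w e - i)) ` ?B i)"
    by (rule card_Un_le)
  also have "\<dots> \<le> (\<Sum>i<W. card ((\<lambda>e. (e, Suc i)) ` ?A i)) + (\<Sum>i<W. card ((\<lambda>e. (e, w e - i)) ` ?B i))"
    by (intro add_mono card_UN_le) auto
  also have "\<dots> \<le> (\<Sum>i<W. card (?A i)) + (\<Sum>i<W. card (?B i))"
    using fin by (intro add_mono sum_mono card_image_le) auto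
  also have "\<dots> \<le> (\<Sum>i<W. M1.rank (?U i)) + (\<Sum>i<W. M2.rank (?V i))"
    by (intro add_mono sum_mono M1.card_le_rank M2.card_le_rank M1.indep_down[OF A] M2.indep_down[OF B]) auto
  finally have "int (card I) \<le> int ((\<Sum>i<W. M1.rank (?U i)) + (\<Sum>i<W. M2.rank (?V i)))"
    by (simp only: of_nat_le_iff)
  then show ?thesis by (simp add: level_rank_sum_def)
qed

text \<open>Take all copies of all elements of \<open>J\<close>: every layer is then a subset of
  \<open>J\<close>.\<close>

lemma unfold_common_independent:
  assumes "matroid N \<I>\<^sub>1" "matroid N \<I>\<^sub>2" and J: "J \<in> \<I>\<^sub>1" "J \<in> \<I>\<^sub>2"
  shows "\<exists>I \<in> unfold_indep1 N w W \<I>\<^sub>1 \<inter> unfold_indep2 N w W \<I>\<^sub>2. card I = (\<Sum>e\<in>J. w e)"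
proof -
  interpret M1: matroid N \<I>\<^sub>1 by fact
  interpret M2: matroid N \<I>\<^sub>2 by fact
  let ?I = "Sigma J (\<lambda>e. {1..w e})"
  have "J \<subseteq> N" using J(1) by (rule M1.indep_subset)
  then have "?I \<subseteq> unfold_ground N w" by (auto simp: unfold_ground_def)
  moreover have "layer1 N ?I i \<in> \<I>\<^sub>1" "layer2 N w ?I i \<in> \<I>\<^sub>2" for i
    by (rule M1.indep_down[OF J(1)] M2.indep_down[OF J(2)]; auto simp: layer1_def layer2_def)+
  moreover have "card ?I = (\<Sum>e\<in>J. w e)" using M1.indep_finite[OF J(1)] by simp
  ultimately show ?thesis by (intro bexI[of _ ?I]) (auto simp: unfold_indep1_def unfold_indep2_def)
qed

theorem theorem1:
  fixes N' :: "'a set" and \<I>\<^sub>1' \<I>\<^sub>2' :: "'a set set" and w :: "'a \<Rightarrow> nat" and W :: nat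
  assumes "matroid N' \<I>\<^sub>1'" and "matroid N' \<I>\<^sub>2'"
    and "\<forall>e \<in> N'. w e \<in> {1..W}"
  shows "max_card_common (unfold_indep1 N' w W \<I>\<^sub>1') (unfold_indep2 N' w W \<I>\<^sub>2')
       = max_weight_common w \<I>\<^sub>1' \<I>\<^sub>2'"
proof -
  interpret M1: matroid N' \<I>\<^sub>1' by fact
  interpret M2: matroid N' \<I>\<^sub>2' by fact
  have w: "\<forall>e\<in>N'. w e \<le> W" using assms(3) by simp
  \<comment> \<open>Both maxima will turn out to be the weight of this \<open>J\<close>.\<close>
  obtain u J where u: "\<forall>e. u e \<le> w e" and J: "J \<subseteq> N'" "M1.rank J = card J" "M2.rank J = card J"
    and le: "level_rank_sum (\<lambda>X. int (M1.rank X)) N' W u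
      + level_rank_sum (\<lambda>X. int (M2.rank X)) N' W (\<lambda>e. w e - u e) \<le> int (\<Sum>e\<in>J. w e)"
    using weight_splitting[OF M1.finite_carrier M1.rank_function_rank M2.rank_function_rank w] by auto
  have "finite J" using J(1) M1.finite_carrier finite_subset by blast
  then have J_indep: "J \<in> \<I>\<^sub>1'" "J \<in> \<I>\<^sub>2'"
    using J M1.indep_if_rank_eq_card M2.indep_if_rank_eq_card by auto
  have card_le: "card I \<le> (\<Sum>e\<in>J. w e)"
    if "I \<in> unfold_indep1 N' w W \<I>\<^sub>1'" "I \<in> unfold_indep2 N' w W \<I>\<^sub>2'" for I
    using unfolded_card_le_level_rank_sum[OF assms(1,2) w u that] le by linarith
  obtain I where I: "I \<in> unfold_indep1 N' w W \<I>\<^sub>1'" "I \<in> unfold_indep2 N' w W \<I>\<^sub>2'"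
    "card I = (\<Sum>e\<in>J. w e)"
    using unfold_common_independent[OF assms(1,2) J_indep] by blast
  have "max_card_common (unfold_indep1 N' w W \<I>\<^sub>1') (unfold_indep2 N' w W \<I>\<^sub>2') = (\<Sum>e\<in>J. w e)"
    unfolding max_card_common_def
  proof (rule Max_eqI)
    show "finite {card I |I. I \<in> unfold_indep1 N' w W \<I>\<^sub>1' \<and> I \<in> unfold_indep2 N' w W \<I>\<^sub>2'}"
      by (rule finite_subset[of _ "{..\<Sum>e\<in>J. w e}"]) (use card_le in blast, simp)
    show "y \<le> (\<Sum>e\<in>J. w e)"
      if "y \<in> {card I |I. I \<in> unfold_indep1 N' w W \<I>\<^sub>1' \<and> I \<in> unfold_indep2 N' w W \<I>\<^sub>2'}" for y
      using that card_le by blast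
    show "(\<Sum>e\<in>J. w e)
        \<in> {card I |I. I \<in> unfold_indep1 N' w W \<I>\<^sub>1' \<and> I \<in> unfold_indep2 N' w W \<I>\<^sub>2'}"
      using I by (metis (mono_tags, lifting) mem_Collect_eq)
  qed
  moreover have "max_weight_common w \<I>\<^sub>1' \<I>\<^sub>2' = (\<Sum>e\<in>J. w e)"
    unfolding max_weight_common_def
  proof (rule Max_eqI)
    show "finite {\<Sum>e\<in>I. w e |I. I \<in> \<I>\<^sub>1' \<and> I \<in> \<I>\<^sub>2'}"
      by (rule finite_subset[of _ "(\<lambda>I. \<Sum>e\<in>I. w e) ` \<I>\<^sub>1'"]) (use M1.finite_indep in auto)
    show "y \<le> (\<Sum>e\<in>J. w e)" if y: "y \<in> {\<Sum>e\<in>I. w e |I. I \<in> \<I>\<^sub>1' \<and> I \<in> \<I>\<^sub>2'}" for y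
    proof -
      \<comment> \<open>Unfolding \<open>I'\<close> gives a common independent set whose cardinality
        is the weight of \<open>I'\<close>, so the bound for the unfolded instance applies.\<close>
      obtain I' where "I' \<in> \<I>\<^sub>1'" "I' \<in> \<I>\<^sub>2'" "y = (\<Sum>e\<in>I'. w e)" using y by blast
      then show ?thesis
        using unfold_common_independent[OF assms(1,2), of I' w W] card_le by (metis IntE)
    qed
  qed (use J_indep in blast)
  ultimately show ?thesis by simp
qed

end
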